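(* Let $\Lambda$ be a repetitive Meyer set in $\mathbb{R}^d$ and let $s$ be the rank of the Abelian group $\langle \Lambda-\Lambda\rangle$. Let $\mathcal{B}$ be a basis of $\langle\Lambda-\Lambda\rangle$ and let $\varphi:\langle\Lambda-\Lambda\rangle\to\mathbb{Z}^s$ be the coordinate map with respect to $\mathcal{B}$. There are an injective linear map $\ell:\mathbb{R}^d\to\mathbb{R}^s$ and a constant $C>0$ such that for every $\Lambda_0\in\Xi_\Lambda$ and every $t\in\Lambda_0$ we have $$\|\varphi(t)-\ell(t)\|_s\le C.$$ Moreover, there is a linear flow $(\mathbb{T}^s,\mathbb{R}^d)$ defined by $$(w,t)\in\mathbb{T}^s\times\mathbb{R}^d\longmapsto w+[\ell(t)]_{\mathbb{Z}^s},$$ and there is a homomorphism (continuous map) $\pi_{\mathrm{Ad}}:\Omega_\Lambda\to\mathbb{T}^s$ such that for every $\Lambda'\in\Omega_\Lambda$ and every $t\in\mathbb{R}^d$ we have $\pi_{\mathrm{Ad}}(\Lambda'-t)=\pi_{\mathrm{Ad}}(\Lambda')+[\ell(t)]_{\mathbb{Z}^s}$.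
   Context: A Delone set in $\mathbb{R}^d$ is a subset that is uniformly discrete (for some $r>0$ every closed ball of radius $r$ contains at most one of its points) and relatively dense (for some $R>0$ every closed ball of radius $R$ contains at least one of its points). A $\rho$-patch of $\Lambda$ centered at $t\in\mathbb{R}^d$ is $\Lambda\cap\overline{B(t,\rho)}$. $\Lambda$ is repetitive if for each $\rho>0$ there is $M>0$ such that every closed ball of radius $M$ contains the center of a translated copy of every $\rho$-patch of $\Lambda$. A Meyer set is a Delone set $\Lambda$ such that $\Lambda-\Lambda$ is a Delone set. For $A\subseteq\mathbb{R}^d$, $\langle A\rangle$ is the subgroup of $\mathbb{R}^d$ generated by $A$; for a repetitive Meyer set, $\langle\Lambda-\Lambda\rangle$ is a finitely generated free Abelian group. The coordinate map with respect to a $\mathbb{Z}$-basis $\{v_1,\dots,v_s\}$ sends $\sum_i m_i v_i$ to $(m_1,\dots,m_s)$. The hull $\Omega_\Lambda$ is the set of all Delone sets in $\mathbb{R}^d$ whose $\rho$-patches, for every $\rho>0$, are $\rho$-patches of $\Lambda$ up to translation. A basis of neighborhoods of $\Lambda'\in\Omega_\Lambda$ is given by the sets $\{\widetilde\Lambda-t : \widetilde\Lambda\in\Omega_\Lambda,\ \widetilde\Lambda\cap\overline{B(0,R)}=\Lambda'\cap\overline{B(0,R)},\ t\in B(0,\varepsilon)\}$ with $0<\varepsilon<R/2$; with this topology $\Omega_\Lambda$ is compact metrizable, and $\mathbb{R}^d$ acts continuously by $(\Lambda',t)\mapsto\Lambda'-t$. The canonical transversal is $\Xi_\Lambda=\{\Lambda'\in\Omega_\Lambda: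 0\in\Lambda'\}$; by repetitivity every $\Lambda_0\in\Xi_\Lambda$ satisfies $\langle\Lambda_0\rangle=\langle\Lambda-\Lambda\rangle$, so $\varphi$ is defined on $\Lambda_0$. $\|\cdot\|_s$ is the Euclidean norm on $\mathbb{R}^s$, $\mathbb{T}^s=\mathbb{R}^s/\mathbb{Z}^s$, and $[u]_{\mathbb{Z}^s}$ is the class of $u\in\mathbb{R}^s$ in $\mathbb{T}^s$. *)

theory Defs
  imports "HOL-Analysis.Analysis" "HOL-Computational_Algebra.Group_Closure"
begin

section \<open>Delone sets, patches, repetitivity, Meyer sets\<close>

definition uniformly_discrete :: "(real^'d) set \<Rightarrow> bool" where
  "uniformly_discrete L \<longleftrightarrow> (\<exists>r>0. \<forall>x. \<forall>p \<in> L \<inter> cball x r. \<forall>q \<in> L \<inter> cball x r. p = q)"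

definition relatively_dense :: "(real^'d) set \<Rightarrow> bool" where
  "relatively_dense L \<longleftrightarrow> (\<exists>R>0. \<forall>x. L \<inter> cball x R \<noteq> {})"

definition Delone :: "(real^'d) set \<Rightarrow> bool" where
  "Delone L \<longleftrightarrow> uniformly_discrete L \<and> relatively_dense L"

definition translate :: "real^'d \<Rightarrow> (real^'d) set \<Rightarrow> (real^'d) set" where
  "translate v L = (\<lambda>x. x + v) ` L"

definition patch :: "(real^'d) set \<Rightarrow> real \<Rightarrow> real^'d \<Rightarrow> (real^'d) set" where
  "patch L \<rho> t = L \<inter> cball t \<rho>"

text \<open>A patch comes with its center: a copy of the patch centered at \<open>t\<close> that is
  translated by \<open>x - t\<close> has center \<open>x\<close>.\<close>

definition repetitive :: "(real^'d) set \<Rightarrow> bool" where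
  "repetitive L \<longleftrightarrow>
     (\<forall>\<rho>>0. \<exists>M>0. \<forall>y t. \<exists>x \<in> cball y M. patch L \<rho> x = translate (x - t) (patch L \<rho> t))"

definition difference_set :: "(real^'d) set \<Rightarrow> (real^'d) set" where
  "difference_set L = {x - y | x y. x \<in> L \<and> y \<in> L}"

definition Meyer :: "(real^'d) set \<Rightarrow> bool" where
  "Meyer L \<longleftrightarrow> Delone L \<and> Delone (difference_set L)"


section \<open>Integral bases and coordinates\<close>

definition int_combination :: "('s::finite \<Rightarrow> real^'d) \<Rightarrow> int^'s \<Rightarrow> real^'d" where
  "int_combination b m = (\<Sum>i\<in>UNIV. of_int (m $ i) *\<^sub>R b i)"

text \<open>A basis is indexed by a finite type, so that its number of elements, the rank of the group,
  is the cardinality of the index type.\<close>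

definition is_int_basis :: "('s::finite \<Rightarrow> real^'d) \<Rightarrow> (real^'d) set \<Rightarrow> bool" where
  "is_int_basis b G \<longleftrightarrow>
     group_closure (range b) = G \<and> (\<forall>m. int_combination b m = 0 \<longrightarrow> m = 0)"

definition coordinates :: "('s::finite \<Rightarrow> real^'d) \<Rightarrow> real^'d \<Rightarrow> int^'s" where
  "coordinates b x = (THE m. x = int_combination b m)"

definition real_vec :: "int^'s \<Rightarrow> real^'s" where
  "real_vec m = (\<chi> i. of_int (m $ i))"


section \<open>The hull and its topology\<close>

definition hull_of :: "(real^'d) set \<Rightarrow> (real^'d) set set" where
  "hull_of L = {L'. Delone L' \<and>
     (\<forall>\<rho>>0. \<forall>t. \<exists>u. patch L' \<rho> t = translate (t - u) (patch L \<rho> u))}"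

lemma hull_ofD:
  assumes "L' \<in> hull_of L" "\<rho> > 0"
  shows "\<exists>u. patch L' \<rho> t = translate (t - u) (patch L \<rho> u)"
  using assms by (simp add: hull_of_def)

definition canonical_transversal :: "(real^'d) set \<Rightarrow> (real^'d) set set" where
  "canonical_transversal L = {L' \<in> hull_of L. 0 \<in> L'}"

definition hull_nbhd :: "(real^'d) set \<Rightarrow> (real^'d) set \<Rightarrow> real \<Rightarrow> real \<Rightarrow> (real^'d) set set" where
  "hull_nbhd L L' R \<epsilon> = {translate (- t) K | K t.
     K \<in> hull_of L \<and> K \<inter> cball 0 R = L' \<inter> cball 0 R \<and> t \<in> ball 0 \<epsilon>}"

definition hull_open :: "(real^'d) set \<Rightarrow> (real^'d) set set \<Rightarrow> bool" where
  "hull_open L U \<longleftrightarrow> U \<subseteq> hull_of L \<and>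
     (\<forall>L' \<in> U. \<exists>R \<epsilon>. 0 < \<epsilon> \<and> \<epsilon> < R / 2 \<and> hull_nbhd L L' R \<epsilon> \<subseteq> U)"

definition hull_topology :: "(real^'d) set \<Rightarrow> (real^'d) set topology" where
  "hull_topology L = topology (hull_open L)"

lemma hull_nbhdI:
  assumes "K \<in> hull_of L" "K \<inter> cball 0 R = L' \<inter> cball 0 R" "norm t < \<epsilon>" "X = translate (- t) K"
  shows "X \<in> hull_nbhd L L' R \<epsilon>"
proof -
  have "t \<in> ball 0 \<epsilon>" using assms(3) by simp
  then show ?thesis unfolding hull_nbhd_def mem_Collect_eq using assms by metis
qed

lemma hull_nbhdE:
  assumes "X \<in> hull_nbhd L L' R \<epsilon>"
  obtains K t where "K \<in> hull_of L" "K \<inter> cball 0 R = L' \<inter> cball 0 R" "norm t < \<epsilon>"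
    "X = translate (- t) K"
  using assms unfolding hull_nbhd_def mem_Collect_eq mem_ball_0 by metis

lemma hull_nbhd_mono:
  assumes "R \<le> R'" "\<epsilon>' \<le> \<epsilon>"
  shows "hull_nbhd L L' R' \<epsilon>' \<subseteq> hull_nbhd L L' R \<epsilon>"
proof
  fix X assume "X \<in> hull_nbhd L L' R' \<epsilon>'"
  then obtain K t where K: "K \<in> hull_of L" and eq: "K \<inter> cball 0 R' = L' \<inter> cball 0 R'"
    and t: "norm t < \<epsilon>'" and X: "X = translate (- t) K"
    by (rule hull_nbhdE)
  have "cball 0 R \<subseteq> cball (0 :: real^'a) R'" using assms(1) by (rule subset_cball)
  then have "K \<inter> cball 0 R = L' \<inter> cball 0 R" using eq by blast
  moreover have "norm t < \<epsilon>" using t assms(2) by linarith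
  ultimately show "X \<in> hull_nbhd L L' R \<epsilon>" using K X hull_nbhdI by metis
qed

lemma istopology_hull_open: "istopology (hull_open L)"
proof -
  have "hull_open L (S \<inter> T)" if S: "hull_open L S" and T: "hull_open L T" for S T
    unfolding hull_open_def
  proof (intro conjI ballI)
    show "S \<inter> T \<subseteq> hull_of L" using S by (auto simp: hull_open_def)
    fix L' assume L': "L' \<in> S \<inter> T"
    obtain R1 e1 where 1: "0 < e1" "e1 < R1 / 2" "hull_nbhd L L' R1 e1 \<subseteq> S"
      using S L' unfolding hull_open_def by blast
    obtain R2 e2 where 2: "0 < e2" "e2 < R2 / 2" "hull_nbhd L L' R2 e2 \<subseteq> T"
      using T L' unfolding hull_open_def by blast
    have "hull_nbhd L L' (max R1 R2) (min e1 e2) \<subseteq> S \<inter> T"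
      using hull_nbhd_mono[of R1 "max R1 R2" "min e1 e2" e1 L L']
        hull_nbhd_mono[of R2 "max R1 R2" "min e1 e2" e2 L L'] 1 2 by auto
    moreover have "0 < min e1 e2" "min e1 e2 < max R1 R2 / 2" using 1 2 by auto
    ultimately show "\<exists>R \<epsilon>. 0 < \<epsilon> \<and> \<epsilon> < R / 2 \<and> hull_nbhd L L' R \<epsilon> \<subseteq> S \<inter> T" by blast
  qed
  moreover have "hull_open L (\<Union>\<K>)" if "\<forall>K\<in>\<K>. hull_open L K" for \<K>
    using that unfolding hull_open_def by (meson Sup_le_iff Union_iff Union_upper subset_trans)
  ultimately show ?thesis unfolding istopology_def by blast
qed

lemma openin_hull_topology: "openin (hull_topology L) U \<longleftrightarrow> hull_open L U"
  by (simp add: hull_topology_def istopology_hull_open)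

lemma mem_translate: "x \<in> translate v L \<longleftrightarrow> x - v \<in> L"
  unfolding translate_def by (auto intro!: image_eqI[of _ _ "x - v"])

lemma translate_translate: "translate u (translate v L) = translate (v + u) L"
  by (auto simp: mem_translate algebra_simps)

lemma translate_0 [simp]: "translate 0 L = L"
  by (simp add: translate_def)

lemma patch_translate: "patch (translate v L) \<rho> t = translate v (patch L \<rho> (t - v))"
  by (auto simp: patch_def mem_translate dist_norm algebra_simps)

lemma Delone_translate:
  assumes "Delone L" shows "Delone (translate v L)"
proof -
  obtain r where r: "r > 0" "\<And>x p q. p \<in> L \<inter> cball x r \<Longrightarrow> q \<in> L \<inter> cball x r \<Longrightarrow> p = q"
    using assms unfolding Delone_def uniformly_discrete_def by blast
  obtain R where R: "R > 0" "\<And>x. L \<inter> cball x R \<noteq> {}"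
    using assms unfolding Delone_def relatively_dense_def by blast
  have *: "translate v L \<inter> cball x s = translate v (L \<inter> cball (x - v) s)" for x s
    using patch_translate[of v L s x] by (simp add: patch_def)
  have "uniformly_discrete (translate v L)"
    unfolding uniformly_discrete_def *
  proof (intro exI[of _ r] conjI allI ballI)
    fix x p q
    assume "p \<in> translate v (L \<inter> cball (x - v) r)" "q \<in> translate v (L \<inter> cball (x - v) r)"
    then show "p = q" using r(2)[of "p - v" "x - v" "q - v"] by (simp add: mem_translate)
  qed (use r in auto)
  moreover have "relatively_dense (translate v L)"
    unfolding relatively_dense_def * using R by (auto simp: translate_def)
  ultimately show ?thesis by (simp add: Delone_def)
qed

lemma hull_of_translate:
  assumes "K \<in> hull_of L" shows "translate v K \<in> hull_of L"
proof -
  have "\<exists>u. patch (translate v K) \<rho> t = translate (t - u) (patch L \<rho> u)" if pos: "\<rho> > 0" for \<rho> t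
  proof -
    obtain u where u: "patch K \<rho> (t - v) = translate (t - v - u) (patch L \<rho> u)"
      using hull_ofD[OF assms pos] by blast
    have "patch (translate v K) \<rho> t = translate (t - u) (patch L \<rho> u)"
      by (simp add: patch_translate u translate_translate)
    then show ?thesis by blast
  qed
  then show ?thesis using assms Delone_translate by (auto simp: hull_of_def)
qed

lemma topspace_hull_topology: "topspace (hull_topology L) = hull_of L"
proof -
  have "hull_nbhd L L' 3 1 \<subseteq> hull_of L" for L'
    unfolding hull_nbhd_def using hull_of_translate by blast
  then have "hull_open L (hull_of L)"
    unfolding hull_open_def by (intro conjI ballI exI[of _ 3] exI[of _ 1]) auto
  then show ?thesis
    unfolding topspace_def openin_hull_topology by (auto simp: hull_open_def)
qed

text \<open>The prescribed neighborhoods are open, so they do form a basis of neighborhoods of \<open>L'\<close>.\<close>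

lemma openin_hull_nbhd:
  assumes "0 < \<epsilon>" "\<epsilon> < R / 2"
  shows "openin (hull_topology L) (hull_nbhd L L' R \<epsilon>)"
  unfolding openin_hull_topology hull_open_def
proof (intro conjI ballI)
  show "hull_nbhd L L' R \<epsilon> \<subseteq> hull_of L"
    unfolding hull_nbhd_def using hull_of_translate by blast
  fix X assume "X \<in> hull_nbhd L L' R \<epsilon>"
  then obtain K t where eq: "K \<inter> cball 0 R = L' \<inter> cball 0 R"
    and t: "norm t < \<epsilon>" and X: "X = translate (- t) K"
    by (rule hull_nbhdE)
  have "hull_nbhd L X (R + \<epsilon>) (\<epsilon> - norm t) \<subseteq> hull_nbhd L L' R \<epsilon>"
  proof
    fix Y assume "Y \<in> hull_nbhd L X (R + \<epsilon>) (\<epsilon> - norm t)"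
    then obtain G u where G: "G \<in> hull_of L"
      and eq': "G \<inter> cball 0 (R + \<epsilon>) = X \<inter> cball 0 (R + \<epsilon>)"
      and u: "norm u < \<epsilon> - norm t" and Y: "Y = translate (- u) G"
      by (rule hull_nbhdE)
    have "y \<in> translate t G \<longleftrightarrow> y \<in> L'" if "norm y \<le> R" for y
    proof -
      have "norm (y - t) \<le> R + \<epsilon>" using that t norm_triangle_ineq4[of y t] by linarith
      then have "y - t \<in> G \<longleftrightarrow> y - t \<in> X" using eq' by (metis Int_iff mem_cball_0)
      moreover have "y \<in> K \<longleftrightarrow> y \<in> L'" using eq that by (metis Int_iff mem_cball_0)
      ultimately show ?thesis by (simp add: mem_translate X)
    qed
    then have "translate t G \<inter> cball 0 R = L' \<inter> cball 0 R" by auto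
    moreover have "Y = translate (- (t + u)) (translate t G)"
      by (simp add: translate_translate Y)
    moreover have "norm (t + u) < \<epsilon>" using u norm_triangle_ineq[of t u] by linarith
    ultimately show "Y \<in> hull_nbhd L L' R \<epsilon>"
      using hull_nbhdI hull_of_translate[OF G] by metis
  qed
  moreover have "0 < \<epsilon> - norm t" using t by simp
  moreover have "\<epsilon> - norm t < (R + \<epsilon>) / 2" using assms norm_ge_zero[of t] by argo
  ultimately show "\<exists>R' \<epsilon>'. 0 < \<epsilon>' \<and> \<epsilon>' < R' / 2 \<and> hull_nbhd L X R' \<epsilon>' \<subseteq> hull_nbhd L L' R \<epsilon>"
    by blast
qed

text \<open>Hence the coordinate map applies to the points of every element of the transversal.\<close>

lemma canonical_transversal_subset:
  assumes "L\<^sub>0 \<in> canonical_transversal L"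
  shows "L\<^sub>0 \<subseteq> group_closure (difference_set L)"
proof
  fix x assume x: "x \<in> L\<^sub>0"
  have "norm x + 1 > 0" using norm_ge_zero[of x] by linarith
  then obtain u where "patch L\<^sub>0 (norm x + 1) 0 = translate (0 - u) (patch L (norm x + 1) u)"
    using assms hull_ofD[of L\<^sub>0 L "norm x + 1" 0] by (auto simp: canonical_transversal_def)
  then have u: "patch L\<^sub>0 (norm x + 1) 0 = translate (- u) (patch L (norm x + 1) u)" by simp
  have "x \<in> patch L\<^sub>0 (norm x + 1) 0" "0 \<in> patch L\<^sub>0 (norm x + 1) 0"
    using x assms by (auto simp: patch_def canonical_transversal_def)
  then have "x + u \<in> L" "u \<in> L" unfolding u by (auto simp: mem_translate patch_def)
  then have "(x + u) - u \<in> difference_set L" unfolding difference_set_def by blast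
  then show "x \<in> group_closure (difference_set L)" by (simp add: group_closure.base)
qed


section \<open>The torus as a topological group\<close>

quotient_type (overloaded) 's torus = "real^('s::finite)" / "\<lambda>x y. \<forall>i. x $ i - y $ i \<in> \<int>"
proof (intro equivpI reflpI sympI transpI allI)
  fix x y :: "real^'s" and i
  assume "\<forall>i. x $ i - y $ i \<in> \<int>"
  then show "y $ i - x $ i \<in> \<int>" using Ints_minus[of "x $ i - y $ i"] by simp
next
  fix x y z :: "real^'s" and i
  assume "\<forall>i. x $ i - y $ i \<in> \<int>" "\<forall>i. y $ i - z $ i \<in> \<int>"
  then show "x $ i - z $ i \<in> \<int>"
    using Ints_add[of "x $ i - y $ i" "y $ i - z $ i"] by simp
qed simp

lift_definition torus_class :: "real^'s \<Rightarrow> ('s::finite) torus" is "\<lambda>x. x" .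

instantiation torus :: (finite) ab_group_add
begin

lift_definition zero_torus :: "'a torus" is 0 .

lift_definition plus_torus :: "'a torus \<Rightarrow> 'a torus \<Rightarrow> 'a torus" is "(+)"
proof -
  fix x x' y y' :: "real^'a" and i
  assume "\<And>i. x $ i - x' $ i \<in> \<int>" "\<And>i. y $ i - y' $ i \<in> \<int>"
  then have "(x $ i - x' $ i) + (y $ i - y' $ i) \<in> \<int>" by (rule Ints_add)
  then show "(x + y) $ i - (x' + y') $ i \<in> \<int>" by (simp add: algebra_simps)
qed

lift_definition uminus_torus :: "'a torus \<Rightarrow> 'a torus" is "uminus"
proof -
  fix x x' :: "real^'a" and i
  assume "\<And>i. x $ i - x' $ i \<in> \<int>"
  then have "- (x $ i - x' $ i) \<in> \<int>" by (intro Ints_minus) auto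
  then show "(- x) $ i - (- x') $ i \<in> \<int>" by simp
qed

lift_definition minus_torus :: "'a torus \<Rightarrow> 'a torus \<Rightarrow> 'a torus" is "(-)"
proof -
  fix x x' y y' :: "real^'a" and i
  assume "\<And>i. x $ i - x' $ i \<in> \<int>" "\<And>i. y $ i - y' $ i \<in> \<int>"
  then have "(x $ i - x' $ i) - (y $ i - y' $ i) \<in> \<int>" by (rule Ints_diff)
  then show "(x - y) $ i - (x' - y') $ i \<in> \<int>" by (simp add: algebra_simps)
qed

instance
  by (standard; transfer; simp add: algebra_simps)

end

instantiation torus :: (finite) topological_space
begin

definition open_torus :: "'a torus set \<Rightarrow> bool" where
  "open_torus U \<longleftrightarrow> open (torus_class -` U)"

instance
  by standard (auto simp: open_torus_def vimage_Union intro: open_Int)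

end


section \<open>Flows\<close>

text \<open>A continuous action of the group \<open>\<real>\<^sup>d\<close>.\<close>

definition is_flow :: "('x::topological_space \<times> (real^'d) \<Rightarrow> 'x) \<Rightarrow> bool" where
  "is_flow f \<longleftrightarrow> continuous_on UNIV f \<and> (\<forall>w. f (w, 0) = w) \<and>
     (\<forall>w t u. f (f (w, t), u) = f (w, t + u))"

end

theory Submission
  imports Defs
begin

text \<open>Coordinates extend along nearest points of \<open>L\<close> to a map \<open>\<psi>\<close> on \<open>\<real>\<^sup>d\<close>. For fixed \<open>y\<close> the increment
  \<open>\<psi> (x + y) - \<psi> x\<close> takes a number of values that is bounded independently of \<open>y\<close>, because
  \<open>L - L\<close> is uniformly discrete, and it moves by bounded steps as \<open>x\<close> runs along a segment. So it is
  constant up to a bounded error, \<open>\<psi>\<close> is additive up to a bounded error, and Hyers' theorem yields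
  \<open>\<ell>\<close>. It is injective since \<open>\<parallel>x\<parallel>\<close> is bounded by a multiple of \<open>\<parallel>\<phi> x\<parallel>\<close>.

  The cocycle \<open>c = \<phi> - \<ell>\<close> is bounded, and the class of \<open>sup {c (x - t) | x \<in> L'} - \<ell> t\<close> modulo
  \<open>\<int>\<^sup>s\<close> does not depend on \<open>t \<in> L'\<close>; it defines \<open>\<pi>\<close>. By repetitivity the oscillation of
  \<open>c\<close> is the same on all elements of the hull, and this makes the supremum continuous.\<close>

section \<open>Quasi-additive maps\<close>

text \<open>For fixed \<open>x\<close> the homogeneity defect
  \<open>h s = f (s *\<^sub>R x) - s *\<^sub>R f x\<close> is additive and vanishes at the integers.
  Hence \<open>h s\<close> depends only on \<open>frac s\<close> and is bounded, and a bounded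
  additive map is zero because \<open>h (n * s) = n *\<^sub>R h s\<close>.\<close>

lemma additive_bounded_imp_linear:
  fixes f :: "'a::real_normed_vector \<Rightarrow> 'b::real_normed_vector"
  assumes add: "\<And>x y. f (x + y) = f x + f y"
    and bdd: "\<And>\<rho>. \<exists>M. \<forall>x. norm x \<le> \<rho> \<longrightarrow> norm (f x) \<le> M"
  shows "linear f"
proof (rule linearI)
  fix r :: real and x :: 'a
  define h where "h s = f (s *\<^sub>R x) - s *\<^sub>R f x" for s
  have h_add: "h (s + t) = h s + h t" for s t
    by (simp add: h_def add scaleR_left_distrib)
  have h_nat: "h (of_nat n * s) = of_nat n *\<^sub>R h s" for n s
  proof (induction n)
    case 0
    show ?case using h_add[of 0 0] by simp
  next
    case (Suc n)
    then show ?case using h_add[of "of_nat n * s" s] by (simp add: algebra_simps)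
  qed
  have h1: "h 1 = 0" by (simp add: h_def)
  have h0: "h 0 = 0" using h_add[of 0 0] by simp
  have h_neg: "h (- s) = - h s" for s
    using h_add[of s "- s"] h0 by (simp add: eq_neg_iff_add_eq_0 add.commute)
  have h_nat1: "h (of_nat n) = 0" for n
    using h_nat[of n 1] h1 by simp
  have h_int: "h (of_int k) = 0" for k
    by (cases k rule: int_cases2) (use h_nat1 h_neg in auto)
  obtain M where M: "\<And>y. norm y \<le> norm x \<Longrightarrow> norm (f y) \<le> M"
    using bdd by blast
  have bd: "norm (h s) \<le> M + norm (f x)" for s
  proof -
    have "h s = h (of_int \<lfloor>s\<rfloor> + frac s)" by (simp add: frac_def)
    then have hs: "h s = h (frac s)" by (simp add: h_add h_int)
    have "norm (h (frac s)) \<le> norm (f (frac s *\<^sub>R x)) + norm (frac s *\<^sub>R f x)"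
      unfolding h_def by (rule norm_triangle_ineq4)
    moreover have fr: "0 \<le> frac s" "frac s \<le> 1" using frac_lt_1[of s] by auto
    moreover have "norm (f (frac s *\<^sub>R x)) \<le> M"
      using fr by (intro M) (simp add: mult_left_le_one_le)
    moreover have "norm (frac s *\<^sub>R f x) \<le> norm (f x)"
      using fr by (simp add: mult_left_le_one_le)
    ultimately show ?thesis unfolding hs by linarith
  qed
  have "h r = 0"
  proof (rule ccontr)
    assume "h r \<noteq> 0"
    then obtain n where "M + norm (f x) < of_nat n * norm (h r)"
      using reals_Archimedean3[of "norm (h r)"] by auto
    then show False using bd[of "of_nat n * r"] by (simp add: h_nat)
  qed
  then show "f (r *\<^sub>R x) = r *\<^sub>R f x" by (simp add: h_def)
qed (rule add)

text \<open>Hyers' theorem: the additive map is the limit of \<open>\<psi> (2\<^sup>k x) / 2\<^sup>k\<close>.\<close>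

lemma quasi_additive_near_additive:
  fixes \<psi> :: "'a::real_vector \<Rightarrow> 'b::banach"
  assumes quasi: "\<And>x y. norm (\<psi> (x + y) - \<psi> x - \<psi> y) \<le> B"
  obtains l where "\<And>x y. l (x + y) = l x + l y" "\<And>x. norm (\<psi> x - l x) \<le> B"
proof -
  have B: "B \<ge> 0" using quasi[of 0 0] norm_ge_zero order_trans by blast
  define a where "a x k = (1 / 2 ^ k) *\<^sub>R \<psi> ((2 ^ k) *\<^sub>R x)" for x and k :: nat
  \<comment> \<open>Successive terms differ by the defect of \<open>\<psi>\<close> when
    \<open>2 ^ k *\<^sub>R x\<close> is doubled, scaled by \<open>1 / 2 ^ Suc k\<close>.\<close>
  have step: "norm (a x (Suc k) - a x k) \<le> B * (1/2) ^ Suc k" for x k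
  proof -
    let ?y = "(2 ^ k) *\<^sub>R x"
    have "a x (Suc k) - a x k = (1 / 2 ^ Suc k) *\<^sub>R (\<psi> (?y + ?y) - \<psi> ?y - \<psi> ?y)"
      by (simp add: a_def scaleR_diff_right flip: scaleR_left_distrib)
         (simp add: algebra_simps flip: scaleR_left_distrib scaleR_left_diff_distrib)
    then have "norm (a x (Suc k) - a x k) = (1 / 2 ^ Suc k) * norm (\<psi> (?y + ?y) - \<psi> ?y - \<psi> ?y)"
      by simp
    also have "\<dots> \<le> (1 / 2 ^ Suc k) * B" by (intro mult_left_mono quasi) auto
    finally show ?thesis by (simp add: power_one_over mult.commute)
  qed
  \<comment> \<open>Starting at exponent 1 makes the sum exactly \<open>B\<close>; as
    \<open>a x 0 = \<psi> x\<close>, the limit stays within \<open>B\<close> of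
    \<open>\<psi> x\<close>.\<close>
  have geo: "(\<lambda>k. B * (1/2) ^ Suc k) sums B"
    using sums_mult[OF power_half_series, of B] by simp
  have summable_norms: "summable (\<lambda>k. norm (a x (Suc k) - a x k))" for x
    by (rule summable_comparison_test'[OF sums_summable[OF geo], of 0]) (simp only: real_norm_def abs_norm_cancel step)
  have summable_steps: "summable (\<lambda>k. a x (Suc k) - a x k)" for x
    using summable_norms by (rule summable_norm_cancel)
  define l where "l x = \<psi> x + (\<Sum>k. a x (Suc k) - a x k)" for x
  have lim: "a x \<longlonglongrightarrow> l x" for x
  proof -
    have "(\<lambda>n. (\<Sum>k<n. a x (Suc k) - a x k)) \<longlonglongrightarrow> (\<Sum>k. a x (Suc k) - a x k)"
      using summable_steps by (rule summable_LIMSEQ)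
    then have "(\<lambda>n. a x n - a x 0) \<longlonglongrightarrow> (\<Sum>k. a x (Suc k) - a x k)"
      by (simp add: sum_lessThan_telescope)
    from tendsto_add[OF tendsto_const[of "a x 0"] this] show ?thesis
      unfolding l_def by (simp add: a_def[of x 0])
  qed
  have "l (x + y) = l x + l y" for x y
  proof -
    have "(\<lambda>k. a (x + y) k - a x k - a y k) \<longlonglongrightarrow> l (x + y) - l x - l y"
      by (intro tendsto_diff lim)
    moreover have "(\<lambda>k. a (x + y) k - a x k - a y k) \<longlonglongrightarrow> 0"
    proof (rule Lim_null_comparison)
      show "\<forall>\<^sub>F k in sequentially. norm (a (x + y) k - a x k - a y k) \<le> B * (1/2) ^ k"
      proof (intro always_eventually allI)
        fix k
        let ?x = "(2 ^ k) *\<^sub>R x" and ?y = "(2 ^ k) *\<^sub>R y"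
        have "a (x + y) k - a x k - a y k = (1 / 2 ^ k) *\<^sub>R (\<psi> (?x + ?y) - \<psi> ?x - \<psi> ?y)"
          by (simp add: a_def algebra_simps)
        then have "norm (a (x + y) k - a x k - a y k) = (1 / 2 ^ k) * norm (\<psi> (?x + ?y) - \<psi> ?x - \<psi> ?y)"
          by simp
        also have "\<dots> \<le> (1 / 2 ^ k) * B" by (intro mult_left_mono quasi) auto
        finally show "norm (a (x + y) k - a x k - a y k) \<le> B * (1/2) ^ k"
          by (simp add: power_one_over mult.commute)
      qed
      show "(\<lambda>k. B * (1/2) ^ k) \<longlonglongrightarrow> 0"
        by (intro tendsto_mult_right_zero LIMSEQ_power_zero) auto
    qed
    ultimately have "l (x + y) - l x - l y = 0" by (rule LIMSEQ_unique)
    then show ?thesis by (simp add: algebra_simps)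
  qed
  moreover have "norm (\<psi> x - l x) \<le> B" for x
  proof -
    have "norm (\<Sum>k. a x (Suc k) - a x k) \<le> (\<Sum>k. norm (a x (Suc k) - a x k))"
      using summable_norms by (rule summable_norm)
    also have "\<dots> \<le> (\<Sum>k. B * (1/2) ^ Suc k)"
      by (intro suminf_le step summable_norms sums_summable[OF geo])
    also have "\<dots> = B" using geo by (simp add: sums_iff)
    finally show ?thesis by (simp add: l_def)
  qed
  ultimately show thesis using that by blast
qed

section \<open>Homomorphisms on the differences of a Meyer set\<close>

text \<open>Excursions that return to an earlier value cost nothing: only the step out of the last
  visit to \<open>a 0\<close> counts, and the tail after it takes at least one value fewer. So the
  bound depends on the number of values, not on the length of the chain.\<close>

lemma chain_dist_bound:
  fixes a :: "nat \<Rightarrow> 'a::metric_space"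
  assumes "\<And>j. j < m \<Longrightarrow> dist (a j) (a (Suc j)) \<le> K"
  shows "dist (a 0) (a m) \<le> of_nat (card (a ` {..m}) - 1) * K"
  using assms
proof (induction m arbitrary: a rule: less_induct)
  case (less m)
  define j where "j = Max {j. j \<le> m \<and> a j = a 0}"
  have fin: "finite {j. j \<le> m \<and> a j = a 0}" by simp
  have "j \<in> {j. j \<le> m \<and> a j = a 0}" unfolding j_def using fin by (intro Max_in) auto
  then have j: "j \<le> m" "a j = a 0" by auto
  have jmax: "a i \<noteq> a 0" if "j < i" "i \<le> m" for i
    using Max_ge[OF fin, of i] that unfolding j_def[symmetric] by auto
  \<comment> \<open>For \<open>m = 0\<close> nothing is known about the sign of \<open>K\<close>,
    but then the factor \<open>card - 1\<close> is 0.\<close>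
  have K: "0 \<le> K" if "m > 0" using less.prems[of 0] that zero_le_dist order_trans by blast
  show ?case
  proof (cases "j = m")
    case True
    then show ?thesis using j K by (cases "m = 0") auto
  next
    case False
    define m' where "m' = m - Suc j"
    have m': "m = m' + Suc j" "m' < m" using False j by (auto simp: m'_def)
    have "dist (a (0 + Suc j)) (a (m' + Suc j)) \<le> of_nat (card ((\<lambda>i. a (i + Suc j)) ` {..m'}) - 1) * K"
      using less.prems m' by (intro less.IH[of m' "\<lambda>i. a (i + Suc j)"]) auto
    moreover have "dist (a j) (a (Suc j)) \<le> K" using less.prems[of j] False j by auto
    moreover have "dist (a 0) (a m) \<le> dist (a j) (a (Suc j)) + dist (a (0 + Suc j)) (a (m' + Suc j))"
      using j(2) dist_triangle[of "a 0" "a m" "a (Suc j)"] m'(1) by simp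
    ultimately have 1: "dist (a 0) (a m) \<le> (1 + of_nat (card ((\<lambda>i. a (i + Suc j)) ` {..m'}) - 1)) * K"
      by (simp add: algebra_simps)
    let ?T = "(\<lambda>i. a (i + Suc j)) ` {..m'}"
    have "insert (a 0) ?T \<subseteq> a ` {..m}" using m' by auto
    then have "card (insert (a 0) ?T) \<le> card (a ` {..m})" by (intro card_mono) auto
    moreover have "a 0 \<notin> ?T"
    proof
      assume "a 0 \<in> ?T"
      then obtain i where "i \<le> m'" "a (i + Suc j) = a 0" by auto
      then show False using jmax[of "i + Suc j"] m' by auto
    qed
    moreover have "card ?T > 0" by (simp add: card_gt_0_iff)
    ultimately have "1 + (card ?T - 1) \<le> card (a ` {..m}) - 1" by simp
    then have "1 + real (card ?T - 1) \<le> real (card (a ` {..m}) - 1)" by linarith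
    then have "(1 + real (card ?T - 1)) * K \<le> real (card (a ` {..m}) - 1) * K"
      using K m' by (intro mult_right_mono) auto
    then show ?thesis using 1 by linarith
  qed
qed

text \<open>Cut the segment from \<open>x\<close> to \<open>y\<close> into steps of length at most
  \<open>R\<close>. The number of steps grows with the distance, but the chain bound only sees the
  number of values.\<close>

lemma finite_range_chain_bound:
  fixes f :: "'a::real_normed_vector \<Rightarrow> 'b::metric_space"
  assumes R: "R > 0" and step: "\<And>x y. dist x y \<le> R \<Longrightarrow> dist (f x) (f y) \<le> K"
    and fin: "finite (range f)" and card: "card (range f) \<le> N"
  shows "dist (f x) (f y) \<le> of_nat N * K"
proof -
  obtain m :: nat where m: "dist x y / R < of_nat m" using reals_Archimedean2 by blast
  have "0 \<le> dist x y / R" using R by simp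
  then have m0: "m > 0" using m by (cases m) auto
  define a where "a j = x + (of_nat j / of_nat m) *\<^sub>R (y - x)" for j :: nat
  have "dist (a j) (a (Suc j)) \<le> R" for j
  proof -
    have "a (Suc j) - a j = (1 / of_nat m) *\<^sub>R (y - x)"
      by (simp add: a_def add_divide_distrib algebra_simps)
    then have "dist (a j) (a (Suc j)) = dist x y / of_nat m"
      by (simp add: dist_norm norm_minus_commute flip: norm_minus_commute[of "a (Suc j)"])
    also have "\<dots> \<le> R" using m m0 R by (simp add: field_simps)
    finally show ?thesis .
  qed
  then have "dist (f (a 0)) (f (a m)) \<le> of_nat (card ((\<lambda>j. f (a j)) ` {..m}) - 1) * K"
    using step by (intro chain_dist_bound) auto
  moreover have "a 0 = x" "a m = y" using m0 by (auto simp: a_def)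
  moreover have "card ((\<lambda>j. f (a j)) ` {..m}) \<le> N"
    by (rule order_trans[OF card_mono[OF fin] card]) auto
  moreover have "0 \<le> K" using step[of x x] R by simp
  then have "of_nat (card ((\<lambda>j. f (a j)) ` {..m}) - 1) * K \<le> of_nat N * K"
    using calculation(4) by (intro mult_right_mono) auto
  ultimately show ?thesis by simp
qed

text \<open>A finite cover of \<open>cball 0 \<rho>\<close> by balls of radius \<open>r\<close> can
  be translated to any center \<open>y\<close>, and each ball holds at most one point of
  \<open>D\<close>. The size of the cover is thus a bound uniform in \<open>y\<close>.\<close>

lemma uniformly_discrete_card_bound:
  assumes "uniformly_discrete D"
  obtains N where "\<And>y. finite (D \<inter> cball y \<rho>)" "\<And>y. card (D \<inter> cball y \<rho>) \<le> N"
proof -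
  obtain r where r: "r > 0" "\<And>x p q. p \<in> D \<inter> cball x r \<Longrightarrow> q \<in> D \<inter> cball x r \<Longrightarrow> p = q"
    using assms unfolding uniformly_discrete_def by blast
  obtain F :: "(real^'a) set" where F: "finite F" "cball 0 \<rho> \<subseteq> (\<Union>x\<in>F. ball x r)"
    using compact_cball[of "0 :: real^'a" \<rho>] r(1) unfolding compact_eq_totally_bounded by blast
  define pick where "pick y p = (SOME x. x \<in> F \<and> p - y \<in> ball x r)" for y p
  have pick: "pick y p \<in> F \<and> p - y \<in> ball (pick y p) r" if "p \<in> cball y \<rho>" for y p
  proof -
    have "p - y \<in> cball 0 \<rho>" using that by (simp add: dist_norm norm_minus_commute)
    then have "\<exists>x. x \<in> F \<and> p - y \<in> ball x r" using F(2) by blast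
    then show ?thesis unfolding pick_def by (rule someI_ex)
  qed
  have "inj_on (pick y) (D \<inter> cball y \<rho>)" for y
  proof (rule inj_onI)
    fix p q assume p: "p \<in> D \<inter> cball y \<rho>" and q: "q \<in> D \<inter> cball y \<rho>" and eq: "pick y p = pick y q"
    have "p \<in> cball (pick y p + y) r" "q \<in> cball (pick y p + y) r"
      using pick[of p y] pick[of q y] p q eq by (auto simp: dist_norm algebra_simps)
    then show "p = q" using r(2) p q by blast
  qed
  moreover have "pick y ` (D \<inter> cball y \<rho>) \<subseteq> F" for y using pick by blast
  ultimately have "finite (D \<inter> cball y \<rho>)" "card (D \<inter> cball y \<rho>) \<le> card F" for y
    using F(1) by (meson finite_subset inj_on_finite, meson card_inj_on_le)
  then show thesis using that by blast
qed

lemma Meyer_homomorphism_almost_linear: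
  fixes L :: "(real^'d) set" and \<Phi> :: "real^'d \<Rightarrow> 'b::banach"
  defines "D \<equiv> difference_set L"
  assumes dense: "relatively_dense L" and discrete: "uniformly_discrete D"
    and hom: "\<And>x y. x \<in> group_closure D \<Longrightarrow> y \<in> group_closure D \<Longrightarrow> \<Phi> (x - y) = \<Phi> x - \<Phi> y"
  obtains l C where "linear l" "\<And>x. x \<in> D \<Longrightarrow> norm (\<Phi> x - l x) \<le> C"
proof -
  obtain R where R: "R > 0" "\<And>x. L \<inter> cball x R \<noteq> {}"
    using dense unfolding relatively_dense_def by blast
  have "\<forall>x. \<exists>y. y \<in> L \<inter> cball x R" using R(2) by blast
  then obtain n where n: "\<And>x. n x \<in> L" "\<And>x. dist x (n x) \<le> R"
    unfolding Int_iff mem_cball by metis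
  have D: "p - q \<in> D" if "p \<in> L" "q \<in> L" for p q
    using that unfolding D_def difference_set_def by blast
  \<comment> \<open>Lets the base point of a difference be moved freely inside
    \<open>L\<close>.\<close>
  have hom3: "\<Phi> (p - q) = \<Phi> (p - r) - \<Phi> (q - r)" if "p \<in> L" "q \<in> L" "r \<in> L" for p q r
    using hom[of "p - r" "q - r"] D that by (simp add: group_closure.base)
  \<comment> \<open>Bounded parts of \<open>D\<close> are finite, so \<open>\<Phi>\<close> is
    bounded on them.\<close>
  have short: "\<exists>M. \<forall>x\<in>D. norm x \<le> \<rho> \<longrightarrow> norm (\<Phi> x) \<le> M" for \<rho>
  proof -
    obtain N where "\<And>y. finite (D \<inter> cball y \<rho>)" "\<And>y. card (D \<inter> cball y \<rho>) \<le> N"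
      by (rule uniformly_discrete_card_bound[OF discrete]) blast
    then have "bounded (\<Phi> ` (D \<inter> cball 0 \<rho>))"
      by (intro finite_imp_bounded finite_imageI)
    then obtain M where "\<forall>z\<in>\<Phi> ` (D \<inter> cball 0 \<rho>). norm z \<le> M" unfolding bounded_iff by blast
    then show ?thesis by (intro exI[of _ M]) (auto simp: image_iff)
  qed
  have near: "norm (n x - n y) \<le> dist x y + 2 * R" for x y
  proof -
    have "dist (n x) (n y) \<le> dist x (n x) + dist x y + dist y (n y)"
      using dist_triangle[of "n x" "n y" x] dist_triangle[of x "n y" y] by (simp add: dist_commute)
    then show ?thesis using n(2)[of x] n(2)[of y] by (simp add: dist_norm)
  qed
  \<comment> \<open>By \<open>near\<close>, points at distance at most \<open>R\<close> give
    differences of norm at most \<open>3 * R\<close>. The radius \<open>2 * R\<close> for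
    \<open>N\<close> is the distance by which \<open>n (x + y) - n x\<close> can miss
    \<open>y\<close>.\<close>
  obtain M where M: "\<And>x. x \<in> D \<Longrightarrow> norm x \<le> 3 * R \<Longrightarrow> norm (\<Phi> x) \<le> M"
    using short[of "3 * R"] by blast
  obtain N where N: "\<And>y. finite (D \<inter> cball y (2 * R))" "\<And>y. card (D \<inter> cball y (2 * R)) \<le> N"
    by (rule uniformly_discrete_card_bound[OF discrete]) blast
  define \<psi> where "\<psi> y = \<Phi> (n y - n 0)" for y
  have psi_diff: "\<Phi> (n x - n y) = \<psi> x - \<psi> y" for x y
    unfolding \<psi>_def by (rule hom3) (rule n)+
  have psi_0: "\<psi> 0 = 0" using psi_diff[of 0 0] by (simp add: \<psi>_def)
  \<comment> \<open>As \<open>x\<close> varies, \<open>n (x + y) - n x\<close> takes at most \<open>N\<close> values, and \<open>\<Phi>\<close> of it changes by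
    at most \<open>2 M\<close> when \<open>x\<close> moves by at most \<open>R\<close>.\<close>
  have quasi: "norm (\<psi> (x + y) - \<psi> x - \<psi> y) \<le> of_nat N * (2 * M)" for x y
  proof -
    define f where "f z = \<Phi> (n (z + y) - n z)" for z
    have sub: "range f \<subseteq> \<Phi> ` (D \<inter> cball y (2 * R))"
    proof (intro image_subsetI imageI, unfold f_def, intro imageI IntI)
      fix z
      show "n (z + y) - n z \<in> D" by (intro D n)
      have "dist y (n (z + y) - n z) = norm ((z + y - n (z + y)) - (z - n z))"
        by (simp add: dist_norm algebra_simps)
      also have "\<dots> \<le> norm (z + y - n (z + y)) + norm (z - n z)" by (rule norm_triangle_ineq4)
      also have "\<dots> \<le> 2 * R" using n(2)[of "z + y"] n(2)[of z] by (simp add: dist_norm)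
      finally show "n (z + y) - n z \<in> cball y (2 * R)" by simp
    qed
    have fin: "finite (range f)" using sub N(1) by (meson finite_imageI finite_subset)
    have "card (range f) \<le> card (\<Phi> ` (D \<inter> cball y (2 * R)))"
      using sub N(1) by (intro card_mono finite_imageI)
    also have "\<dots> \<le> N" using card_image_le[OF N(1)] N(2) order_trans by blast
    finally have card: "card (range f) \<le> N" .
    have step: "dist (f u) (f v) \<le> 2 * M" if "dist u v \<le> R" for u v
    proof -
      have "f u - f v = \<Phi> (n (u + y) - n (v + y)) - \<Phi> (n u - n v)"
        unfolding f_def psi_diff by simp
      then have "dist (f u) (f v) \<le> norm (\<Phi> (n (u + y) - n (v + y))) + norm (\<Phi> (n u - n v))"
        by (simp add: dist_norm norm_triangle_ineq4)
      also have "\<dots> \<le> M + M"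
        using near[of u v] near[of "u + y" "v + y"] that
        by (intro add_mono M D n) auto
      finally show ?thesis by simp
    qed
    \<comment> \<open>Since \<open>\<psi> 0 = 0\<close>, the increment at 0 is
      \<open>\<psi> y\<close>, so \<open>f x - f 0\<close> is the defect of additivity.\<close>
    have "dist (f x) (f 0) \<le> of_nat N * (2 * M)"
      using R(1) step fin card by (rule finite_range_chain_bound)
    moreover have "f x - f 0 = \<psi> (x + y) - \<psi> x - \<psi> y"
      unfolding f_def psi_diff by (simp add: psi_0)
    ultimately show ?thesis by (simp add: dist_norm)
  qed
  obtain l where l: "\<And>x y. l (x + y) = l x + l y" "\<And>x. norm (\<psi> x - l x) \<le> of_nat N * (2 * M)"
    using quasi_additive_near_additive[OF quasi] by blast
  have "linear l"
  proof (rule additive_bounded_imp_linear[OF l(1)])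
    fix \<rho>
    obtain M' where M': "\<And>x. x \<in> D \<Longrightarrow> norm x \<le> \<rho> + 2 * R \<Longrightarrow> norm (\<Phi> x) \<le> M'"
      using short by blast
    have "norm (l x) \<le> M' + of_nat N * (2 * M)" if "norm x \<le> \<rho>" for x
    proof -
      have "norm (\<psi> x) \<le> M'"
        unfolding \<psi>_def using near[of x 0] that by (intro M' D n) auto
      then show ?thesis using l(2)[of x] norm_triangle_ineq4[of "\<psi> x" "\<psi> x - l x"] by simp
    qed
    then show "\<exists>M. \<forall>x. norm x \<le> \<rho> \<longrightarrow> norm (l x) \<le> M" by blast
  qed
  \<comment> \<open>Write \<open>x = p - q\<close> with \<open>p\<close>, \<open>q\<close> in
    \<open>L\<close>. Replacing \<open>p\<close> and \<open>q\<close> by \<open>n p\<close> and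
    \<open>n q\<close> costs \<open>M\<close> each; the defect of \<open>\<psi>\<close> at
    \<open>(x, q)\<close> and the distance from \<open>\<psi> x\<close> to \<open>l x\<close> cost
    \<open>N * (2 * M)\<close> each.\<close>
  moreover have "norm (\<Phi> x - l x) \<le> 2 * M + 2 * (of_nat N * (2 * M))" if x: "x \<in> D" for x
  proof -
    obtain p q where pq: "p \<in> L" "q \<in> L" "x = p - q"
      using x unfolding D_def difference_set_def by blast
    have xq: "x + q = p" using pq by simp
    have close: "norm (\<Phi> (r - n r)) \<le> M" if "r \<in> L" for r
      using n(2)[of r] R(1) that by (intro M D n) (auto simp: dist_norm)
    have "\<Phi> x = \<Phi> (p - n 0) - \<Phi> (q - n 0)" unfolding pq using pq n by (intro hom3)
    also have "\<Phi> (p - n 0) = \<Phi> (p - n p) + \<psi> p"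
      unfolding \<psi>_def by (simp add: hom3[of p "n p" "n 0"] pq n)
    also have "\<Phi> (q - n 0) = \<Phi> (q - n q) + \<psi> q"
      unfolding \<psi>_def by (simp add: hom3[of q "n q" "n 0"] pq n)
    finally have "\<Phi> x - l x =
        \<Phi> (p - n p) - \<Phi> (q - n q) + ((\<psi> (x + q) - \<psi> x - \<psi> q) + (\<psi> x - l x))"
      by (simp add: xq)
    then have "norm (\<Phi> x - l x) \<le> norm (\<Phi> (p - n p) - \<Phi> (q - n q)) +
        (norm (\<psi> (x + q) - \<psi> x - \<psi> q) + norm (\<psi> x - l x))"
      by (simp only:) (intro norm_triangle_le add_left_mono norm_triangle_ineq)
    also have "\<dots> \<le> (M + M) + (of_nat N * (2 * M) + of_nat N * (2 * M))"
      using norm_triangle_ineq4[of "\<Phi> (p - n p)" "\<Phi> (q - n q)"] close[OF pq(1)] close[OF pq(2)]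
      by (intro add_mono quasi l(2)) linarith
    finally show ?thesis by (simp add: mult.commute)
  qed
  ultimately show thesis using that by blast
qed

section \<open>Coordinates and the torus\<close>

lemma int_combination_diff: "int_combination b (m - n) = int_combination b m - int_combination b n"
  by (simp add: int_combination_def scaleR_left_diff_distrib sum_subtractf)

lemma int_combination_axis: "int_combination b (axis i 1) = b i"
proof -
  have "of_int (axis i 1 $ j) *\<^sub>R b j = (if j = i then b j else 0)" for j
    by (simp add: axis_def)
  then show ?thesis by (simp add: int_combination_def)
qed

text \<open>Bounded coordinates force a bounded vector; this is what makes \<open>l\<close>
  injective.\<close>

lemma norm_int_combination_le:
  "norm (int_combination b m) \<le> norm (real_vec m) * (\<Sum>i\<in>UNIV. norm (b i))"
proof -
  have "norm (int_combination b m) \<le> (\<Sum>i\<in>UNIV. norm (of_int (m $ i) *\<^sub>R b i))"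
    unfolding int_combination_def by (rule norm_sum)
  also have "\<dots> \<le> (\<Sum>i\<in>UNIV. norm (real_vec m) * norm (b i))"
  proof (rule sum_mono)
    fix i
    have "\<bar>of_int (m $ i)\<bar> \<le> norm (real_vec m)"
      using component_le_norm_cart[of "real_vec m" i] by (simp add: real_vec_def)
    then show "norm (of_int (m $ i) *\<^sub>R b i) \<le> norm (real_vec m) * norm (b i)"
      by (simp add: mult_right_mono)
  qed
  finally show ?thesis by (simp add: sum_distrib_left)
qed

text \<open>Makes the definite description in \<open>coordinates\<close> meaningful: existence by
  induction over the generated group, uniqueness by independence of the basis.\<close>

lemma int_combination_coordinates:
  assumes b: "is_int_basis b G" and x: "x \<in> G"
  shows "int_combination b (coordinates b x) = x"
proof -
  have "x \<in> group_closure (range b)" using assms by (simp add: is_int_basis_def)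
  then have "\<exists>m. x = int_combination b m"
  proof induction
    case (base s)
    have "0 = int_combination b 0" by (simp add: int_combination_def)
    then show ?case using base int_combination_axis[of b] by (metis imageE insertE)
  next
    case (diff s t)
    then show ?case using int_combination_diff by metis
  qed
  moreover have "m = n" if "x = int_combination b m" "x = int_combination b n" for m n
  proof -
    have "int_combination b (m - n) = 0" using that int_combination_diff[of b m n] by simp
    then show ?thesis using b unfolding is_int_basis_def by (metis right_minus_eq)
  qed
  ultimately have "\<exists>!m. x = int_combination b m" by blast
  then show ?thesis unfolding coordinates_def by (metis (mono_tags, lifting) theI')
qed

lemma coordinates_diff:
  assumes b: "is_int_basis b G" and x: "x \<in> G" and y: "y \<in> G"
  shows "coordinates b (x - y) = coordinates b x - coordinates b y"
proof -
  have "x - y \<in> G" using assms unfolding is_int_basis_def by (metis group_closure.diff)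
  then have "int_combination b (coordinates b (x - y) - (coordinates b x - coordinates b y)) = 0"
    using int_combination_coordinates[OF b] x y by (simp add: int_combination_diff)
  then show ?thesis using b unfolding is_int_basis_def by (metis right_minus_eq)
qed

lemma real_vec_diff: "real_vec (m - n) = real_vec m - real_vec n"
  by (simp add: real_vec_def vec_eq_iff)

section \<open>The projection onto the torus and linear flows\<close>

lemma torus_class_add: "torus_class (x + y) = torus_class x + torus_class y"
  by transfer simp

lemma torus_class_eq_iff: "torus_class x = torus_class y \<longleftrightarrow> (\<forall>i. x $ i - y $ i \<in> \<int>)"
  by transfer simp

lemma surj_torus_class: "\<exists>x. w = torus_class x"
  by transfer (metis Ints_0 diff_self)

text \<open>The saturation of \<open>U\<close> is the union of its translates by integer vectors,
  hence open.\<close>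

lemma open_torus_class_image:
  assumes "open U" shows "open (torus_class ` U)"
proof -
  have "torus_class -` (torus_class ` U) = (\<Union>k\<in>{k. \<forall>i. k $ i \<in> \<int>}. (\<lambda>x. k + x) ` U)" (is "?l = ?r")
  proof
    show "?l \<subseteq> ?r"
    proof
      fix x assume "x \<in> ?l"
      then obtain y where y: "y \<in> U" "\<forall>i. x $ i - y $ i \<in> \<int>"
        unfolding vimage_def image_def by (auto simp: torus_class_eq_iff)
      show "x \<in> ?r"
      proof (rule UN_I)
        show "x - y \<in> {k. \<forall>i. k $ i \<in> \<int>}" using y(2) by simp
        show "x \<in> (\<lambda>z. (x - y) + z) ` U" using y(1) by (intro image_eqI[of _ _ y]) simp_all
      qed
    qed
    show "?r \<subseteq> ?l"
    proof
      fix x assume "x \<in> ?r"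
      then obtain k y where "\<forall>i. k $ i \<in> \<int>" "y \<in> U" "x = k + y" by blast
      moreover from this have "torus_class x = torus_class y" by (simp add: torus_class_eq_iff)
      ultimately show "x \<in> ?l" by auto
    qed
  qed
  then show ?thesis using assms by (auto simp: open_torus_def open_translation)
qed

text \<open>The quotient topology controls maps on the torus alone, not on its product with
  \<open>real^'d\<close>. Openness of the projection bridges this: a product neighborhood for the
  lifted map projects to a product neighborhood.\<close>

lemma is_flow_torus_linear:
  fixes l :: "real^'d \<Rightarrow> real^'s::finite"
  assumes l: "linear l"
  shows "is_flow (\<lambda>(w :: 's torus, t). w + torus_class (l t))"
  unfolding is_flow_def
proof (intro conjI allI)
  let ?f = "\<lambda>(w :: 's torus, t). w + torus_class (l t)"
  have cont: "continuous_on UNIV (\<lambda>(x, t). x + l t)"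
    unfolding case_prod_beta
    by (intro continuous_intros linear_continuous_on_compose[OF _ l])
  have "open (?f -` V)" if "open V" for V
  proof -
    let ?W = "(\<lambda>(x, t). x + l t) -` (torus_class -` V)"
    have "open ?W" using cont that by (simp add: open_torus_def open_vimage)
    have "\<exists>A B. open A \<and> open B \<and> z \<in> A \<times> B \<and> A \<times> B \<subseteq> ?f -` V" if z: "z \<in> ?f -` V" for z
    proof -
      obtain x t where xt: "z = (torus_class x, t)" using surj_torus_class by (metis surj_pair)
      then have "(x, t) \<in> ?W" using z by (simp add: torus_class_add)
      from open_prod_elim[OF \<open>open ?W\<close> this] obtain A B
        where AB: "open A" "open B" "(x, t) \<in> A \<times> B" "A \<times> B \<subseteq> ?W" .
      have "torus_class ` A \<times> B \<subseteq> ?f -` V"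
      proof
        fix z' assume "z' \<in> torus_class ` A \<times> B"
        then obtain y u where yu: "z' = (torus_class y, u)" "(y, u) \<in> A \<times> B" by blast
        then have "(y, u) \<in> ?W" using AB(4) by blast
        then show "z' \<in> ?f -` V" by (simp add: yu(1) torus_class_add)
      qed
      then show ?thesis
        using AB open_torus_class_image xt by (intro exI[of _ "torus_class ` A"] exI[of _ B]) auto
    qed
    then show ?thesis unfolding open_prod_def by blast
  qed
  then show "continuous_on UNIV ?f" by (simp add: continuous_on_open_vimage)
  fix w :: "'s torus" and t u
  have "torus_class (0 :: real^'s) = 0" by transfer simp
  then show "?f (w, 0) = w" using linear_0[OF l] by simp
  show "?f (?f (w, t), u) = ?f (w, t + u)"
    by (simp add: linear_add[OF l] torus_class_add add.assoc)
qed

section \<open>The factor map on the hull\<close>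

text \<open>Two points of \<open>L'\<close> lie in a common patch around 0, and that patch is a
  translate of a patch of \<open>L\<close>.\<close>

lemma difference_set_hull_subset:
  assumes "L' \<in> hull_of L"
  shows "difference_set L' \<subseteq> difference_set L"
proof
  fix x assume "x \<in> difference_set L'"
  then obtain p q where pq: "p \<in> L'" "q \<in> L'" "x = p - q"
    unfolding difference_set_def by blast
  define \<rho> where "\<rho> = norm p + norm q + 1"
  have "\<rho> > 0" unfolding \<rho>_def by (simp add: add_nonneg_pos)
  then obtain u where u: "patch L' \<rho> 0 = translate (0 - u) (patch L \<rho> u)"
    using hull_ofD[OF assms] by blast
  have "p \<in> patch L' \<rho> 0" "q \<in> patch L' \<rho> 0" using pq by (auto simp: patch_def \<rho>_def)
  then have "p + u \<in> L" "q + u \<in> L" unfolding u by (auto simp: mem_translate patch_def)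
  moreover have "x = (p + u) - (q + u)" using pq by simp
  ultimately show "x \<in> difference_set L" unfolding difference_set_def by blast
qed

text \<open>By repetitivity a patch of \<open>L\<close> containing \<open>p\<close> and
  \<open>q\<close> recurs in every ball of radius \<open>M\<close>, hence inside any sufficiently
  large patch of \<open>L'\<close>.\<close>

lemma difference_set_subset_hull:
  assumes rep: "repetitive L" and L': "L' \<in> hull_of L"
  shows "difference_set L \<subseteq> difference_set L'"
proof
  fix x assume "x \<in> difference_set L"
  then obtain p q where pq: "p \<in> L" "q \<in> L" "x = p - q"
    unfolding difference_set_def by blast
  define \<rho> where "\<rho> = norm x + 1"
  have \<rho>: "\<rho> > 0" unfolding \<rho>_def by (simp add: add_nonneg_pos)
  obtain M where M: "M > 0" "\<And>y t. \<exists>v \<in> cball y M. patch L \<rho> v = translate (v - t) (patch L \<rho> t)"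
    using rep \<rho> unfolding repetitive_def by blast
  \<comment> \<open>The recurring copy has its center within \<open>M\<close> of \<open>u\<close>
    and radius \<open>\<rho>\<close>, so a patch of radius \<open>M + \<rho>\<close> contains
    it.\<close>
  have "M + \<rho> > 0" using M(1) \<rho> by simp
  then obtain u where u: "patch L' (M + \<rho>) 0 = translate (0 - u) (patch L (M + \<rho>) u)"
    using hull_ofD[OF L'] by blast
  obtain v where v: "v \<in> cball u M" "patch L \<rho> v = translate (v - q) (patch L \<rho> q)"
    using M(2) by blast
  have "p \<in> patch L \<rho> q" "q \<in> patch L \<rho> q"
    using pq by (auto simp: patch_def \<rho>_def dist_norm norm_minus_commute)
  then have "p + (v - q) \<in> patch L \<rho> v" "v \<in> patch L \<rho> v"
    unfolding v(2) by (auto simp: mem_translate)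
  moreover have "w - u \<in> L'" if "w \<in> patch L \<rho> v" for w
  proof -
    have "dist u w \<le> M + \<rho>"
      using that v(1) dist_triangle[of u w v] by (auto simp: patch_def)
    then have "w - u \<in> patch L' (M + \<rho>) 0"
      using that unfolding u by (simp add: mem_translate patch_def)
    then show ?thesis by (simp add: patch_def)
  qed
  ultimately have "p + (v - q) - u \<in> L'" "v - u \<in> L'" by auto
  moreover have "x = (p + (v - q) - u) - (v - u)" using pq by simp
  ultimately show "x \<in> difference_set L'" unfolding difference_set_def by blast
qed

lemma hull_of_nonempty: "L' \<in> hull_of L \<Longrightarrow> L' \<noteq> {}"
  unfolding hull_of_def Delone_def relatively_dense_def by blast

text \<open>Abstracts \<open>c = \<phi> - \<ell>\<close>: additive on the whole group, but bounded
  only on the differences.\<close>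

locale bounded_hull_cocycle =
  fixes L :: "(real^'d) set" and c :: "real^'d \<Rightarrow> real^'s::finite" and C :: real
  assumes repetitive: "repetitive L"
    and diff: "\<And>x y. x \<in> group_closure (difference_set L) \<Longrightarrow> y \<in> group_closure (difference_set L) \<Longrightarrow>
      c (x - y) = c x - c y"
    and bound: "\<And>x. x \<in> difference_set L \<Longrightarrow> norm (c x) \<le> C"
begin

text \<open>Up to sign, the height at \<open>0\<close> is the transfer function of the Gottschalk--Hedlund theorem for the
  cocycle \<open>c\<close> on the transversal.\<close>

definition height :: "(real^'d) set \<Rightarrow> real^'d \<Rightarrow> real^'s" where
  "height L' t = (\<chi> i. SUP x\<in>L'. c (x - t) $ i)"

lemma component_bound: "x \<in> difference_set L \<Longrightarrow> \<bar>c x $ i\<bar> \<le> C"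
  using bound component_le_norm_cart order_trans by blast

lemma hull_diff_mem:
  assumes "L' \<in> hull_of L" "x \<in> L'" "y \<in> L'"
  shows "x - y \<in> difference_set L"
  using assms difference_set_hull_subset unfolding difference_set_def by blast

lemma cocycle:
  assumes "L' \<in> hull_of L" "x \<in> L'" "y \<in> L'" "z \<in> L'"
  shows "c (x - y) = c (x - z) - c (y - z)"
  using diff[of "x - z" "y - z"] hull_diff_mem[OF assms(1)] assms
  by (simp add: group_closure.base)

lemma le_height:
  assumes "L' \<in> hull_of L" "x \<in> L'" "t \<in> L'"
  shows "c (x - t) $ i \<le> height L' t $ i"
proof -
  have "bdd_above ((\<lambda>x. c (x - t) $ i) ` L')"
    using component_bound hull_diff_mem[OF assms(1)] assms(3)
      by (intro bdd_aboveI2[of _ _ C]) (meson abs_le_D1)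
  then show ?thesis using assms(2) by (auto simp: height_def intro: cSUP_upper)
qed

lemma height_le:
  assumes "L' \<in> hull_of L" "\<And>x. x \<in> L' \<Longrightarrow> c (x - t) $ i \<le> b"
  shows "height L' t $ i \<le> b"
  using assms hull_of_nonempty[OF assms(1)] by (auto simp: height_def intro: cSUP_least)

text \<open>A new reference point shifts all the values under the supremum by one constant. The
  converse inequality is the same one with \<open>t\<close> and \<open>u\<close> exchanged.\<close>

lemma height_change_point:
  assumes L': "L' \<in> hull_of L" and t: "t \<in> L'" and u: "u \<in> L'"
  shows "height L' u = height L' t + c (t - u)"
proof -
  have le: "height L' u $ i \<le> height L' t $ i + c (t - u) $ i" if "t \<in> L'" "u \<in> L'" for t u i
  proof (rule height_le[OF L'])
    fix x assume "x \<in> L'"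
    then show "c (x - u) $ i \<le> height L' t $ i + c (t - u) $ i"
      using cocycle[OF L', of x t u] le_height[OF L', of x t i] that by simp
  qed
  have "c (u - t) = - c (t - u)"
    using cocycle[OF L', of u t u] cocycle[OF L', of u u u] t u by simp
  then have "height L' t $ i + c (t - u) $ i \<le> height L' u $ i" for i
    using le[of u t i] t u by simp
  then show ?thesis using le[of t u] t u by (simp add: vec_eq_iff antisym)
qed

lemma height_translate: "height (translate v L') (t + v) = height L' t"
  by (simp add: height_def translate_def image_image)

text \<open>The supremum \<open>\<omega>\<close> of a component of \<open>c\<close> over the differences is the same for all elements of the
  hull. If \<open>p - q\<close> almost attains it, then \<open>p\<close> almost maximizes that component in every element of the
  hull that contains \<open>p\<close> and \<open>q\<close>.\<close>

lemma height_component_stable: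
  assumes L': "L' \<in> hull_of L" and t: "t \<in> L'" and e: "e > 0"
  shows "\<exists>F. finite F \<and> F \<subseteq> L' \<and>
    (\<forall>K\<in>hull_of L. F \<subseteq> K \<longrightarrow> \<bar>height K t $ i - height L' t $ i\<bar> \<le> e)"
proof -
  define \<omega> where "\<omega> = (SUP x\<in>difference_set L. c x $ i)"
  have bdd: "bdd_above ((\<lambda>x. c x $ i) ` difference_set L)"
    using component_bound by (intro bdd_aboveI2[of _ _ C]) (meson abs_le_D1)
  have ne: "difference_set L \<noteq> {}" using hull_diff_mem[OF L' t t] by blast
  have "\<omega> - e < \<omega>" using e by simp
  then obtain x where x: "x \<in> difference_set L" "\<omega> - e < c x $ i"
    unfolding \<omega>_def less_cSUP_iff[OF ne bdd] by blast
  then obtain p q where pq: "p \<in> L'" "q \<in> L'" "x = p - q"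
    using difference_set_subset_hull[OF repetitive L'] unfolding difference_set_def by blast
  \<comment> \<open>The interval of length \<open>e\<close> depends on \<open>p\<close> and
    \<open>t\<close> only, so it traps the heights of \<open>K\<close> and \<open>L'\<close>
    alike.\<close>
  have near: "c (p - t) $ i \<le> height K t $ i \<and> height K t $ i \<le> c (p - t) $ i + e"
    if K: "K \<in> hull_of L" "{p, q, t} \<subseteq> K" for K
  proof (intro conjI)
    show "c (p - t) $ i \<le> height K t $ i" using K by (intro le_height) auto
    show "height K t $ i \<le> c (p - t) $ i + e"
    proof (rule height_le[OF K(1)])
      fix y assume y: "y \<in> K"
      \<comment> \<open>From the reference point \<open>q\<close>, no point exceeds
        \<open>\<omega>\<close> and \<open>p\<close> comes within \<open>e\<close> of it; the
        cocycle identity carries this over to \<open>t\<close>.\<close>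
      have "c (y - q) $ i \<le> \<omega>"
        unfolding \<omega>_def using K y by (intro cSUP_upper bdd hull_diff_mem[OF K(1)]) auto
      then have "c (y - q) $ i \<le> c (p - q) $ i + e" using x pq by simp
      then show "c (y - t) $ i \<le> c (p - t) $ i + e"
        using cocycle[OF K(1), of y q t] cocycle[OF K(1), of p q t] y K(2) by simp
    qed
  qed
  have "\<bar>height K t $ i - height L' t $ i\<bar> \<le> e" if "K \<in> hull_of L" "{p, q, t} \<subseteq> K" for K
    using near[OF that] near[OF L'] pq t by auto
  then show ?thesis using pq t by (intro exI[of _ "{p, q, t}"]) auto
qed

lemma height_stable:
  assumes L': "L' \<in> hull_of L" and t: "t \<in> L'" and e: "e > 0"
  obtains R where "R > 0" "\<And>K. K \<in> hull_of L \<Longrightarrow> K \<inter> cball 0 R = L' \<inter> cball 0 R \<Longrightarrow>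
    t \<in> K \<and> norm (height K t - height L' t) \<le> e"
proof -
  \<comment> \<open>The norm is estimated by the sum of the components, one share of
    \<open>e\<close> for each.\<close>
  define e' where "e' = e / real CARD('s)"
  have "e' > 0" using e by (simp add: e'_def)
  then have "\<exists>F. finite F \<and> F \<subseteq> L' \<and>
      (\<forall>K\<in>hull_of L. F \<subseteq> K \<longrightarrow> \<bar>height K t $ i - height L' t $ i\<bar> \<le> e')" for i
    by (rule height_component_stable[OF L' t])
  then obtain F where F: "\<And>i. finite (F i)" "\<And>i. F i \<subseteq> L'"
    "\<And>i K. K \<in> hull_of L \<Longrightarrow> F i \<subseteq> K \<Longrightarrow> \<bar>height K t $ i - height L' t $ i\<bar> \<le> e'"
    by metis
  have "bounded (insert t (\<Union>i. F i))" using F(1) by (intro finite_imp_bounded) auto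
  then obtain R where R: "R > 0" "\<And>x. x \<in> insert t (\<Union>i. F i) \<Longrightarrow> norm x \<le> R"
    unfolding bounded_pos by blast
  show thesis
  proof (rule that[OF R(1)])
    fix K assume K: "K \<in> hull_of L" "K \<inter> cball 0 R = L' \<inter> cball 0 R"
    have mem: "x \<in> K" if "x \<in> insert t (\<Union>i. F i)" for x
    proof -
      have "x \<in> L' \<inter> cball 0 R" using that R(2) F(2) t by auto
      then show ?thesis using K(2) by blast
    qed
    have "norm (height K t - height L' t) \<le> (\<Sum>i\<in>UNIV. \<bar>(height K t - height L' t) $ i\<bar>)"
      by (rule norm_le_l1_cart)
    also have "\<dots> \<le> (\<Sum>i\<in>(UNIV :: 's set). e')"
      using F(3)[OF K(1)] mem by (intro sum_mono) (auto simp: subset_iff)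
    also have "\<dots> = e" by (simp add: e'_def)
    finally show "t \<in> K \<and> norm (height K t - height L' t) \<le> e" using mem by blast
  qed
qed

text \<open>Continuity is unaffected by the arbitrary choice of \<open>t\<close> in
  \<open>\<pi>\<close>: elements that agree with \<open>L'\<close> on a large ball contain the same
  \<open>t\<close>, and their classes can be computed from it.\<close>

lemma torus_factor_exists:
  fixes l :: "real^'d \<Rightarrow> real^'s"
  assumes l: "linear l"
    and integral: "\<And>x i. x \<in> difference_set L \<Longrightarrow> (c x + l x) $ i \<in> \<int>"
  shows "\<exists>\<pi>. continuous_map (hull_topology L) euclidean \<pi> \<and>
    (\<forall>L' \<in> hull_of L. \<forall>t. \<pi> (translate (- t) L') = \<pi> L' + torus_class (l t))"
proof -
  define \<pi> where "\<pi> L' = (let t = SOME t. t \<in> L' in torus_class (height L' t - l t))" for L'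
  have \<pi>: "\<pi> L' = torus_class (height L' t - l t)" if L': "L' \<in> hull_of L" "t \<in> L'" for L' t
  proof -
    define u where "u = (SOME u. u \<in> L')"
    have u: "u \<in> L'" unfolding u_def using that(2) by (rule someI)
    \<comment> \<open>The discrepancy of two reference points is a value of \<open>c + l\<close> on
      a difference, hence integral.\<close>
    have "(height L' u - l u) - (height L' t - l t) = c (t - u) + l (t - u)"
      unfolding height_change_point[OF L' u] by (simp add: linear_diff[OF l])
    then have "((height L' u - l u) - (height L' t - l t)) $ i \<in> \<int>" for i
      using integral[OF hull_diff_mem[OF L' u]] by simp
    then have "torus_class (height L' u - l u) = torus_class (height L' t - l t)"
      unfolding torus_class_eq_iff by simp
    then show ?thesis by (simp add: \<pi>_def u_def)
  qed
  have equivariant: "\<pi> (translate (- v) L') = \<pi> L' + torus_class (l v)" if L': "L' \<in> hull_of L" for L' v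
  proof -
    obtain t where t: "t \<in> L'" using hull_of_nonempty[OF L'] by blast
    have "t + (- v) \<in> translate (- v) L'" using t by (simp add: mem_translate)
    then have "\<pi> (translate (- v) L') = torus_class (height (translate (- v) L') (t + (- v)) - l (t + (- v)))"
      by (rule \<pi>[OF hull_of_translate[OF L']])
    also have "\<dots> = torus_class ((height L' t - l t) + l v)"
      unfolding height_translate by (simp add: linear_diff[OF l] algebra_simps)
    finally show ?thesis by (simp add: \<pi>[OF L' t] torus_class_add)
  qed
  have "hull_open L {L' \<in> hull_of L. \<pi> L' \<in> U}" if U: "open U" for U
    unfolding hull_open_def
  proof (intro conjI ballI)
    fix L' assume "L' \<in> {L' \<in> hull_of L. \<pi> L' \<in> U}"
    then have L': "L' \<in> hull_of L" "\<pi> L' \<in> U" by auto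
    obtain t where t: "t \<in> L'" using hull_of_nonempty[OF L'(1)] by blast
    have "open (torus_class -` U)" using U by (simp add: open_torus_def)
    moreover have "height L' t - l t \<in> torus_class -` U" using L' t \<pi> by simp
    ultimately obtain e where e: "e > 0" "ball (height L' t - l t) e \<subseteq> torus_class -` U"
      using open_contains_ball by blast
    obtain B where B: "B > 0" "\<And>x. norm (l x) \<le> B * norm x"
      using linear_bounded_pos[OF l] by blast
    have "e / 2 > 0" using e(1) by simp
    obtain R where R: "R > 0"
      "\<And>K. K \<in> hull_of L \<Longrightarrow> K \<inter> cball 0 R = L' \<inter> cball 0 R \<Longrightarrow>
        t \<in> K \<and> norm (height K t - height L' t) \<le> e / 2"
      using height_stable[OF L'(1) t \<open>e / 2 > 0\<close>] by metis
    \<comment> \<open>The first bound keeps \<open>l v\<close> below \<open>e / 2\<close>, the other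
      half of \<open>e\<close> being used for the height; the second gives
      \<open>\<delta> < R / 2\<close>.\<close>
    define \<delta> where "\<delta> = min (e / (2 * B)) (R / 3)"
    have \<delta>: "0 < \<delta>" "\<delta> < R / 2" using e(1) B(1) R(1) by (auto simp: \<delta>_def)
    have "hull_nbhd L L' R \<delta> \<subseteq> {L' \<in> hull_of L. \<pi> L' \<in> U}"
    proof
      fix X assume "X \<in> hull_nbhd L L' R \<delta>"
      then obtain K v where K: "K \<in> hull_of L" "K \<inter> cball 0 R = L' \<inter> cball 0 R"
        and v: "norm v < \<delta>" and X: "X = translate (- v) K"
        by (rule hull_nbhdE)
      have tK: "t \<in> K" and h: "norm (height K t - height L' t) \<le> e / 2" using R(2)[OF K] by auto
      have "norm v < e / (2 * B)" using v by (simp add: \<delta>_def)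
      then have "B * norm v < e / 2" using B(1) by (simp add: field_simps)
      then have "norm (l v) < e / 2" using B(2)[of v] by linarith
      then have "norm ((height K t - height L' t) + l v) < e"
        using h norm_triangle_ineq[of "height K t - height L' t" "l v"] by linarith
      moreover have "dist (height L' t - l t) (height K t - l t + l v) =
          norm ((height K t - height L' t) + l v)"
        unfolding dist_norm norm_minus_commute[of "height L' t - l t"] by (simp add: algebra_simps)
      ultimately have "height K t - l t + l v \<in> ball (height L' t - l t) e" by simp
      then have "height K t - l t + l v \<in> torus_class -` U" using e(2) by (rule rev_subsetD)
      then have "\<pi> X \<in> U" unfolding X equivariant[OF K(1)] \<pi>[OF K(1) tK] by (simp add: torus_class_add)
      then show "X \<in> {L' \<in> hull_of L. \<pi> L' \<in> U}" using hull_of_translate[OF K(1)] X by simp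
    qed
    then show "\<exists>R \<epsilon>. 0 < \<epsilon> \<and> \<epsilon> < R / 2 \<and> hull_nbhd L L' R \<epsilon> \<subseteq> {L' \<in> hull_of L. \<pi> L' \<in> U}"
      using \<delta> by blast
  qed auto
  then have "continuous_map (hull_topology L) euclidean \<pi>"
    unfolding continuous_map_def by (simp add: topspace_hull_topology openin_hull_topology)
  then show ?thesis using equivariant by blast
qed

end

section \<open>Injectivity of the linear map and assembly of the results\<close>

theorem proposition1p1:
  fixes L :: "(real^'d) set" and b :: "'s::finite \<Rightarrow> real^'d"
  assumes "Meyer L" and "repetitive L"
    and "is_int_basis b (group_closure (difference_set L))"
  shows "\<exists>(l :: real^'d \<Rightarrow> real^'s) C. linear l \<and> inj l \<and> C > 0 \<and>
           (\<forall>L\<^sub>0 \<in> canonical_transversal L. \<forall>t \<in> L\<^sub>0.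
              norm (real_vec (coordinates b t) - l t) \<le> C) \<and>
           is_flow (\<lambda>(w :: 's torus, t). w + torus_class (l t)) \<and>
           (\<exists>\<pi>. continuous_map (hull_topology L) euclidean \<pi> \<and>
              (\<forall>L' \<in> hull_of L. \<forall>t. \<pi> (translate (- t) L') = \<pi> L' + torus_class (l t)))"
proof -
  let ?D = "difference_set L"
  define \<Phi> where "\<Phi> x = real_vec (coordinates b x)" for x
  have dense: "relatively_dense L" and discrete: "uniformly_discrete ?D"
    using assms(1) by (auto simp: Meyer_def Delone_def)
  have \<Phi>_diff: "\<Phi> (x - y) = \<Phi> x - \<Phi> y" if "x \<in> group_closure ?D" "y \<in> group_closure ?D" for x y
    using coordinates_diff[OF assms(3) that] by (simp add: \<Phi>_def real_vec_diff)
  obtain l C where l: "linear l" and C: "\<And>x. x \<in> ?D \<Longrightarrow> norm (\<Phi> x - l x) \<le> C"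
    using Meyer_homomorphism_almost_linear[OF dense discrete \<Phi>_diff] by blast
  obtain p where p: "p \<in> L" using dense unfolding relatively_dense_def by blast
  have "0 \<in> ?D" using p unfolding difference_set_def by force
  then have "C \<ge> 0" using C norm_ge_zero order_trans by blast
  \<comment> \<open>Along a kernel direction, points of \<open>L\<close> near
    \<open>p + k *\<^sub>R v\<close> differ from \<open>p\<close> by vectors with bounded
    \<open>l\<close>, hence bounded \<open>\<Phi>\<close>, hence bounded norm, although
    \<open>real k * norm v\<close> is unbounded.\<close>
  have "v = 0" if v: "l v = 0" for v
  proof (rule ccontr)
    assume "v \<noteq> 0"
    obtain R where R: "\<And>x. L \<inter> cball x R \<noteq> {}"
      using dense unfolding relatively_dense_def by blast
    obtain B where B: "B > 0" "\<And>x. norm (l x) \<le> B * norm x"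
      using linear_bounded_pos[OF l] by blast
    define S where "S = (\<Sum>i\<in>UNIV. norm (b i))"
    have S: "S \<ge> 0" unfolding S_def by (intro sum_nonneg) simp
    \<comment> \<open>\<open>C + B * R\<close> bounds \<open>\<Phi> (q - p)\<close>, the factor
      \<open>S\<close> turns this into a bound on \<open>norm (q - p)\<close>, and \<open>R\<close>
      is the distance from \<open>q\<close> to \<open>p + k *\<^sub>R v\<close>.\<close>
    obtain k :: nat where k: "(C + B * R) * S + R < real k * norm v"
      using reals_Archimedean3 \<open>v \<noteq> 0\<close> by (metis zero_less_norm_iff)
    obtain q where q: "q \<in> L" "norm (p + real k *\<^sub>R v - q) \<le> R"
      using R[of "p + real k *\<^sub>R v"] by (auto simp: dist_norm)
    have D: "q - p \<in> ?D" using p q unfolding difference_set_def by blast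
    have "l (q - p) = - l (p + real k *\<^sub>R v - q)"
      by (simp add: linear_diff[OF l] linear_add[OF l] linear_cmul[OF l] v)
    then have "norm (l (q - p)) \<le> B * norm (p + real k *\<^sub>R v - q)" using B(2) by simp
    also have "\<dots> \<le> B * R" using q(2) B(1) by simp
    finally have "norm (\<Phi> (q - p)) \<le> C + B * R"
      using C[OF D] norm_triangle_ineq[of "\<Phi> (q - p) - l (q - p)" "l (q - p)"] by simp
    then have "norm (\<Phi> (q - p)) * S \<le> (C + B * R) * S" using S by (rule mult_right_mono)
    moreover have "norm (q - p) \<le> norm (\<Phi> (q - p)) * S"
      using norm_int_combination_le[of b "coordinates b (q - p)"] D
        int_combination_coordinates[OF assms(3), of "q - p"]
      by (simp add: \<Phi>_def S_def group_closure.base)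
    moreover have "real k *\<^sub>R v = (q - p) + (p + real k *\<^sub>R v - q)" by simp
    then have "real k * norm v \<le> norm (q - p) + norm (p + real k *\<^sub>R v - q)"
      by (metis norm_scaleR norm_triangle_ineq abs_of_nat)
    ultimately show False using k q(2) by linarith
  qed
  then have "inj l" using l by (simp add: linear_injective_0)
  \<comment> \<open>Points of \<open>L\<^sub>0\<close> are differences since 0 is in
    \<open>L\<^sub>0\<close>. Only \<open>C \<ge> 0\<close> is known, so 1 is added to get a
    positive constant.\<close>
  moreover have "norm (real_vec (coordinates b t) - l t) \<le> C + 1"
    if "L\<^sub>0 \<in> canonical_transversal L" "t \<in> L\<^sub>0" for L\<^sub>0 t
  proof -
    have "t - 0 \<in> difference_set L\<^sub>0" "L\<^sub>0 \<in> hull_of L"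
      using that unfolding canonical_transversal_def difference_set_def by blast+
    then have "t \<in> ?D" using difference_set_hull_subset by auto
    then show ?thesis using C[of t] by (simp add: \<Phi>_def)
  qed
  moreover have "\<exists>\<pi>. continuous_map (hull_topology L) euclidean \<pi> \<and>
      (\<forall>L' \<in> hull_of L. \<forall>t. \<pi> (translate (- t) L') = \<pi> L' + torus_class (l t))"
  proof -
    interpret bounded_hull_cocycle L "\<lambda>x. \<Phi> x - l x" C
      using assms(2) C by unfold_locales (auto simp: \<Phi>_diff linear_diff[OF l])
    show ?thesis
      \<comment> \<open>Here \<open>c + l\<close> is \<open>\<Phi>\<close>, whose components are
        integers by construction.\<close>
      by (rule torus_factor_exists[OF l]) (simp add: \<Phi>_def real_vec_def)
  qed
  ultimately show ?thesis
    using l is_flow_torus_linear[OF l] \<open>C \<ge> 0\<close> by (intro exI[of _ l] exI[of _ "C + 1"]) auto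
qed

end
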